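(* Let $m$ be a positive integer, let $n\in\{2m,2m+1\}$, and let $F(x)=x^{2^{m+1}-1}$ be the power mapping on $\mathbb{F}_{2^n}$. Then the Feistel boomerang extended uniformity of $F$ satisfies $$\beta_e(F)=\begin{cases}2^m,&\text{if }n=2m;\\ 2,&\text{if }n=2m+1.\end{cases}$$
   Context: $\mathbb{F}_{2^n}$ is the finite field with $2^n$ elements. For a mapping $F:\mathbb{F}_{2^n}\to\mathbb{F}_{2^n}$ and $(a,c,b,d)\in\mathbb{F}_{2^n}^4$, the Feistel Boomerang Extended Table (FBET) entry is $$\mathrm{FBET}_F(a,c,b,d)=|\{x\in\mathbb{F}_{2^n}: F(x)+F(x+a)+F(x+b)+F(x+a+b)=0,\ F(x)+F(x+a)=c,\ F(x+a)+F(x+a+b)=d\}|.$$ The Feistel boomerang extended uniformity of $F$ is $$\beta_e(F)=\max_{(a,c,b,d)\in\mathbb{F}_{2^n}^4\setminus\{(0,0,0,0)\}}\mathrm{FBET}_F(a,c,b,d).$$ *)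

theory Defs
  imports Main "HOL-Library.Cardinality"
begin

definition FBET :: "('a::{field,finite} \<Rightarrow> 'a) \<Rightarrow> 'a \<Rightarrow> 'a \<Rightarrow> 'a \<Rightarrow> 'a \<Rightarrow> nat" where
  "FBET F a c b d =
     card {x. F x + F (x + a) + F (x + b) + F (x + a + b) = 0 \<and>
              F x + F (x + a) = c \<and>
              F (x + a) + F (x + a + b) = d}"

definition feistel_boomerang_extended_uniformity :: "('a::{field,finite} \<Rightarrow> 'a) \<Rightarrow> nat" where
  "feistel_boomerang_extended_uniformity F =
     Max {FBET F a c b d | a c b d. (a, c, b, d) \<noteq> (0, 0, 0, 0)}"

end

theory Submission
  imports Defs "HOL-Computational_Algebra.Primes" "HOL-Computational_Algebra.Polynomial"
begin

text \<open>If \<open>a \<noteq> 0\<close>, the entry at \<open>(a, c, b, d)\<close> counts some of the solutions of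
  \<open>F x + F (x + a) = c\<close>; if \<open>a = 0\<close>, it counts some of the solutions of
  \<open>F x + F (x + b) = d\<close>; and \<open>b = d = 0\<close> gives all solutions of the first equation. So the
  extended uniformity is the differential uniformity, and for a power map only the shift \<open>1\<close>
  matters. Put \<open>\<sigma> x = x ^ 2 ^ (m + 1)\<close>. Since \<open>x * F x = \<sigma> x\<close>, every solution of
  \<open>F x + F (x + 1) = c\<close> satisfies \<open>\<sigma> x = c * x\<^sup>2 + (1 + c) * x\<close>. Applying \<open>\<sigma>\<close> once more and
  using that \<open>\<sigma> (\<sigma> x)\<close> is \<open>x\<^sup>2\<close> or \<open>x ^ 4\<close> yields, for \<open>c \<noteq> 1\<close>, a nonzero quartic
  with the additional roots \<open>0\<close> and \<open>1\<close>, hence at most two solutions. For \<open>c = 1\<close> the solutions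
  are those of \<open>\<sigma> x = x\<^sup>2\<close>: only \<open>0\<close> and \<open>1\<close> for odd \<open>n\<close>, and the subfield with
  \<open>2 ^ m\<close> elements for \<open>n = 2 * m\<close>.\<close>

section \<open>Finite fields of characteristic two\<close>

lemma of_nat_CARD_eq_0: "of_nat CARD('a::{ring_1,finite}) = (0::'a)"
proof -
  \<comment> \<open>Translation by 1 permutes the ring, so adding \<open>CARD('a)\<close> copies of
    1 leaves the sum of all elements unchanged.\<close>
  have "(\<Sum>x\<in>(UNIV::'a set). x) = (\<Sum>x\<in>UNIV. x + 1)"
    by (rule sum.reindex_bij_witness[of _ "\<lambda>x. x + 1" "\<lambda>x. x - 1"]) auto
  then show ?thesis
    by (simp add: sum.distrib)
qed

text \<open>The library states this only for the class \<open>finite_field\<close>, which is not implied by the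
  sort \<open>{field,finite}\<close>.\<close>

lemma power_CARD_eq: "x ^ CARD('a) = (x::'a::{field,finite})"
proof (cases "x = 0")
  case False
  let ?U = "UNIV - {0::'a}"
  have "(\<Prod>y\<in>?U. y) = (\<Prod>y\<in>?U. x * y)"
    using False
    by (intro prod.reindex_bij_witness[of _ "\<lambda>y. x * y" "\<lambda>y. y / x"]) auto
  also have "\<dots> = x ^ card ?U * (\<Prod>y\<in>?U. y)"
    by (simp add: prod.distrib)
  finally have "x ^ card ?U = 1"
    by simp
  moreover have "CARD('a) = Suc (card ?U)"
    by (simp add: card_Diff_singleton finite_UNIV_card_ge_0)
  ultimately show ?thesis
    by (metis power_Suc mult_1_right)
qed (simp add: finite_UNIV_card_ge_0)

lemma two_eq_0_if_CARD_power_2: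
  assumes "CARD('a::{field,finite}) = 2 ^ n"
  shows "(2::'a) = 0"
  using of_nat_CARD_eq_0[where 'a='a] assms by simp

lemma char_2_double:
  assumes "(2::'a::field) = 0"
  shows "(x::'a) + x = 0" and "x + (x + y) = y"
  using assms by (metis mult_2 mult_zero_left, metis add.assoc add_0 mult_2 mult_zero_left)

lemma char_2_add_eq_0_iff:
  assumes "(2::'a::field) = 0"
  shows "(x::'a) + y = 0 \<longleftrightarrow> x = y"
  by (metis assms char_2_double(1) add_left_cancel)

lemma frobenius_add:
  assumes "(2::'a::field) = 0"
  shows "((x::'a) + y) ^ 2 ^ k = x ^ 2 ^ k + y ^ 2 ^ k"
proof (rule freshmans_dream')
  have "CHAR('a) dvd 2"
    using assms of_nat_eq_0_iff_char_dvd[of 2, where 'a='a] by simp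
  then have "CHAR('a) = 2"
    using prime_nat_iff[of 2] CHAR_not_1'[where 'a='a] by auto
  then show "prime CHAR('a)" and "2 ^ k = CHAR('a) ^ k"
    by simp_all
qed

section \<open>Reduction to the difference distribution table\<close>

definition ddt :: "('a::{field,finite} \<Rightarrow> 'a) \<Rightarrow> 'a \<Rightarrow> 'a \<Rightarrow> nat" where
  "ddt F a c = card {x. F x + F (x + a) = c}"

lemma FBET_0_0:
  assumes "(2::'a::{field,finite}) = 0"
  shows "FBET F a c 0 0 = ddt F a (c::'a)"
proof -
  have "y + z + y + z = 0" for y z :: 'a
    using char_2_double(1)[OF assms, of "y + z"] by (simp add: add.assoc)
  then show ?thesis
    by (simp add: FBET_def ddt_def char_2_double(1)[OF assms])
qed

lemma FBET_le_ddt: "FBET F a c b d \<le> ddt F a c"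
  unfolding FBET_def ddt_def by (rule card_mono) auto

lemma FBET_0_le_ddt: "FBET F 0 c b d \<le> ddt F b d"
  unfolding FBET_def ddt_def by (rule card_mono) auto

text \<open>For \<open>a = b = 0\<close> a bound by \<open>ddt\<close> would be useless, since
  \<open>ddt F 0 0\<close> counts the whole field. But both differences vanish there, which
  contradicts \<open>c\<close> or \<open>d\<close> being nonzero.\<close>

lemma FBET_0_0_eq_0:
  assumes "(2::'a::{field,finite}) = 0" and "(c, d) \<noteq> (0, 0)"
  shows "FBET F 0 c 0 (d::'a) = 0"
  using assms(2) by (auto simp: FBET_def char_2_double[OF assms(1)])

lemma feistel_boomerang_extended_uniformity_eqI:
  fixes F :: "'a::{field,finite} \<Rightarrow> 'a"
  assumes "(2::'a) = 0" and le: "\<And>a c. a \<noteq> 0 \<Longrightarrow> ddt F a c \<le> N"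
    and "a \<noteq> 0" and eq: "ddt F a c = N"
  shows "feistel_boomerang_extended_uniformity F = N"
  unfolding feistel_boomerang_extended_uniformity_def
proof (rule Max_eqI)
  have "{FBET F a c b d |a c b d. (a, c, b, d) \<noteq> (0, 0, 0, 0)} \<subseteq> {..CARD('a)}"
    by (auto simp: FBET_def intro!: card_mono)
  then show "finite {FBET F a c b d |a c b d. (a, c, b, d) \<noteq> (0, 0, 0, 0)}"
    by (rule finite_subset) simp
  show "N \<in> {FBET F a c b d |a c b d. (a, c, b, d) \<noteq> (0, 0, 0, 0)}"
    unfolding eq[symmetric] FBET_0_0[OF assms(1), symmetric] using \<open>a \<noteq> 0\<close> by blast
next
  fix k assume "k \<in> {FBET F a c b d |a c b d. (a, c, b, d) \<noteq> (0, 0, 0, 0)}"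
  then obtain a c b d where k: "k = FBET F a c b d" and nz: "(a, c, b, d) \<noteq> (0, 0, 0, 0)"
    by blast
  consider "a \<noteq> 0" | "a = 0" "b \<noteq> 0" | "a = 0" "b = 0"
    by blast
  then show "k \<le> N"
  proof cases
    case 1
    then show ?thesis
      using le_trans[OF FBET_le_ddt le] k by blast
  next
    case 2
    then show ?thesis
      using le_trans[OF FBET_0_le_ddt le] k by blast
  next
    case 3
    then show ?thesis
      using FBET_0_0_eq_0[OF assms(1)] nz k by auto
  qed
qed

section \<open>Derivatives of power maps\<close>

lemma ddt_power_eq:
  assumes "a \<noteq> (0::'a::{field,finite})"
  shows "ddt (\<lambda>x. x ^ k) a c = ddt (\<lambda>x. x ^ k) 1 (c / a ^ k)"
proof -
  have "(a * z) ^ k + (a * z + a) ^ k = c \<longleftrightarrow> z ^ k + (z + 1) ^ k = c / a ^ k" for z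
  proof -
    have "(a * z) ^ k + (a * z + a) ^ k = a ^ k * (z ^ k + (z + 1) ^ k)"
      using power_mult_distrib[of a "z + 1" k] by (simp add: power_mult_distrib distrib_left)
    then show ?thesis
      using assms by (auto simp: field_simps)
  qed
  then have "bij_betw (\<lambda>z. a * z) {z. z ^ k + (z + 1) ^ k = c / a ^ k} {x. x ^ k + (x + a) ^ k = c}"
    using assms
    by (intro bij_betw_byWitness[of _ "\<lambda>x. x / a"]) force+
  then show ?thesis
    unfolding ddt_def using bij_betw_same_card by fastforce
qed

text \<open>Multiplying by \<open>z * (z + 1)\<close> completes both exponents to
  \<open>2 ^ k\<close>, where powering is additive. The converse fails in general: 0 and 1 solve the
  resulting equation for every \<open>c\<close>.\<close>

lemma ddt_1_equation:
  fixes z :: "'a::field"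
  assumes two: "(2::'a) = 0"
    and "z ^ (2 ^ k - 1) + (z + 1) ^ (2 ^ k - 1) = c"
  shows "z ^ 2 ^ k = c * z\<^sup>2 + (1 + c) * z"
proof -
  have F: "x * x ^ (2 ^ k - 1) = x ^ 2 ^ k" for x :: 'a
    using power_minus_mult[of "2 ^ k" x] by (simp add: mult.commute)
  have "c * (z\<^sup>2 + z) = (z + 1) * (z * z ^ (2 ^ k - 1)) + z * ((z + 1) * (z + 1) ^ (2 ^ k - 1))"
    unfolding assms(2)[symmetric] by algebra
  also have "\<dots> = (z + 1) * z ^ 2 ^ k + z * (z ^ 2 ^ k + 1)"
    unfolding F frobenius_add[OF two] by simp
  also have "\<dots> = z ^ 2 ^ k + z + 2 * (z * z ^ 2 ^ k)"
    by (simp add: algebra_simps)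
  finally have "c * (z\<^sup>2 + z) + z = z ^ 2 ^ k"
    using two char_2_double(1)[OF two] by (simp add: add.assoc)
  then show ?thesis
    by (simp add: algebra_simps)
qed

text \<open>The coefficients \<open>u\<close> and \<open>v\<close> let one argument serve both
  parities of \<open>n\<close>.\<close>

lemma ddt_1_le_2:
  fixes c u v :: "'a::{field,finite}"
  assumes two: "(2::'a) = 0" and "k > 0" and "c \<noteq> 1"
    and iter: "\<And>z::'a. (z ^ 2 ^ k) ^ 2 ^ k = u * z\<^sup>2 + v * z ^ 4"
  shows "ddt (\<lambda>x. x ^ (2 ^ k - 1)) 1 c \<le> 2"
proof -
  define S where "S = {z::'a. z ^ (2 ^ k - 1) + (z + 1) ^ (2 ^ k - 1) = c}"
  define B where "B = c ^ 2 ^ k"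
  \<comment> \<open>Raise \<open>z ^ 2 ^ k = c * z\<^sup>2 + (1 + c) * z\<close> to the power
    \<open>2 ^ k\<close> and substitute it into the result. The cubic coefficient is a multiple of
    2, hence zero.\<close>
  define p where "p = [:0, (1 + B) * (1 + c), B * (1 + c)\<^sup>2 + (1 + B) * c - u, 0, B * c\<^sup>2 - v:]"
  \<comment> \<open>The linear coefficient of \<open>p\<close> is thus a power of
    \<open>1 + c\<close>.\<close>
  have "1 + B = (1 + c) ^ 2 ^ k"
    by (simp add: B_def frobenius_add[OF two])
  moreover have "1 + c \<noteq> 0"
    using \<open>c \<noteq> 1\<close> char_2_add_eq_0_iff[OF two, of 1 c] by simp
  ultimately have "p \<noteq> 0"
    by (simp add: p_def)
  have root: "poly p z = 0" if *: "z ^ 2 ^ k = c * z\<^sup>2 + (1 + c) * z" for z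
  proof -
    have "u * z\<^sup>2 + v * z ^ 4 = (c * z\<^sup>2 + (1 + c) * z) ^ 2 ^ k"
      unfolding iter[symmetric] * ..
    also have "\<dots> = B * (z ^ 2 ^ k)\<^sup>2 + (1 + B) * z ^ 2 ^ k"
      by (simp add: B_def frobenius_add[OF two] power_mult_distrib power_mult[symmetric] mult.commute)
    also have "\<dots> = B * (c * z\<^sup>2 + (1 + c) * z)\<^sup>2 + (1 + B) * (c * z\<^sup>2 + (1 + c) * z)"
      unfolding * ..
    finally have "B * (c * z\<^sup>2 + (1 + c) * z)\<^sup>2 + (1 + B) * (c * z\<^sup>2 + (1 + c) * z)
        - (u * z\<^sup>2 + v * z ^ 4) = 0"
      by simp
    moreover have "poly p z = B * (c * z\<^sup>2 + (1 + c) * z)\<^sup>2 + (1 + B) * (c * z\<^sup>2 + (1 + c) * z)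
        - (u * z\<^sup>2 + v * z ^ 4) - 2 * (B * c * (1 + c) * z ^ 3)"
      by (simp add: p_def) algebra
    ultimately show ?thesis
      using two by simp
  qed
  \<comment> \<open>As the exponent is positive, 0 and 1 both give the value 1, not
    \<open>c\<close>.\<close>
  have "(2::nat) ^ k - 1 \<noteq> 0"
    using \<open>k > 0\<close> one_less_power[of "2::nat" k] by simp
  then have "{0, 1} \<inter> S = {}"
    using \<open>c \<noteq> 1\<close> two by (auto simp: S_def power_0_left)
  then have "card (S \<union> {0, 1}) = card S + 2"
    by (subst card_Un_disjoint) auto
  moreover have "S \<union> {0, 1} \<subseteq> {z. poly p z = 0}"
  proof -
    have "S \<subseteq> {z. poly p z = 0}"
      using ddt_1_equation[OF two] root by (auto simp: S_def)
    moreover have "poly p 0 = 0" "poly p 1 = 0"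
      using two char_2_double[OF two] by (auto intro!: root)
    ultimately show ?thesis
      by auto
  qed
  then have "card (S \<union> {0, 1}) \<le> card {z. poly p z = 0}"
    by (rule card_mono[rotated]) simp
  moreover have "card {z. poly p z = 0} \<le> 4"
    by (rule le_trans[OF card_poly_roots_bound[OF \<open>p \<noteq> 0\<close>]]) (simp add: p_def)
  ultimately show ?thesis
    by (simp add: ddt_def S_def)
qed

lemma ddt_1_1:
  assumes two: "(2::'a::{field,finite}) = 0" and "k > 0"
  shows "ddt (\<lambda>x. x ^ (2 ^ k - 1)) 1 (1::'a) = card {z::'a. z ^ 2 ^ k = z\<^sup>2}"
proof -
  have "z ^ (2 ^ k - 1) + (z + 1) ^ (2 ^ k - 1) = 1 \<longleftrightarrow> z ^ 2 ^ k = z\<^sup>2" (is "?L \<longleftrightarrow> ?R") for z :: 'a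
  proof
    assume ?L
    then show ?R
      using ddt_1_equation[OF two \<open>?L\<close>] two by simp
  next
    assume R: ?R
    \<comment> \<open>The power map is the identity on solutions of the right-hand equation, and
      these are closed under adding 1.\<close>
    have F: "x ^ (2 ^ k - 1) = x" if "x ^ 2 ^ k = x\<^sup>2" for x :: 'a
    proof (cases "x = 0")
      case True
      then show ?thesis
        using one_less_power[of "2::nat" k] \<open>k > 0\<close> by (simp add: power_0_left)
    next
      case False
      have "x * x ^ (2 ^ k - 1) = x * x"
        using that power_minus_mult[of "2 ^ k" x] by (simp add: power2_eq_square mult.commute)
      then show ?thesis
        using False by simp
    qed
    have "(z + 1) ^ 2 ^ k = (z + 1)\<^sup>2"
      using R two by (simp add: frobenius_add[OF two] power2_sum)
    then show ?L
      using F[OF R] F[of "z + 1"] char_2_double[OF two] by simp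
  qed
  then show ?thesis
    by (simp add: ddt_def)
qed

section \<open>The subfield of index two\<close>

lemma card_fixed_points_half_frobenius:
  assumes card: "CARD('a::{field,finite}) = 2 ^ (2 * m)"
  shows "card {z::'a. z ^ 2 ^ m = z} = 2 ^ m"
proof (cases "m = 0")
  case True
  with card show ?thesis
    by simp
next
  case False
  let ?K = "{z::'a. z ^ 2 ^ m = z}"
  \<comment> \<open>This is the relative trace. Its kernel is \<open>?K\<close>, its image lies in
    \<open>?K\<close>, and its fibres are translates of the kernel or empty, so the field has at
    most \<open>(card ?K)\<^sup>2\<close> elements.\<close>
  define \<phi> where "\<phi> z = z ^ 2 ^ m + z" for z :: 'a
  have two: "(2::'a) = 0"
    using two_eq_0_if_CARD_power_2[OF card] .
  have K: "z \<in> ?K \<longleftrightarrow> \<phi> z = 0" for z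
    by (simp add: \<phi>_def char_2_add_eq_0_iff[OF two])
  have add: "\<phi> (x + y) = \<phi> x + \<phi> y" for x y
    by (simp add: \<phi>_def frobenius_add[OF two])
  have "(z ^ 2 ^ m) ^ 2 ^ m = z" for z :: 'a
    using power_CARD_eq[of z] by (simp add: card power_mult[symmetric] power_add[symmetric] mult_2)
  then have im: "\<phi> ` UNIV \<subseteq> ?K"
    by (auto simp: \<phi>_def frobenius_add[OF two])
  have fibre: "card (\<phi> -` {y}) \<le> card ?K" for y
  proof (cases "\<phi> -` {y} = {}")
    case False
    then obtain x where "\<phi> x = y"
      by auto
    then have "(\<lambda>z. x + z) ` (\<phi> -` {y}) \<subseteq> ?K"
      using K add char_2_double[OF two] by auto
    then have "card ((\<lambda>z. x + z) ` (\<phi> -` {y})) \<le> card ?K"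
      by (intro card_mono) auto
    then show ?thesis
      by (simp add: card_image)
  qed simp
  have "CARD('a) = card (\<Union>y\<in>\<phi> ` UNIV. \<phi> -` {y})"
    by (rule arg_cong[where f = card]) auto
  also have "\<dots> \<le> (\<Sum>y\<in>\<phi> ` UNIV. card (\<phi> -` {y}))"
    by (rule card_UN_le) simp
  also have "\<dots> \<le> card (\<phi> ` UNIV) * card ?K"
    using sum_bounded_above[of "\<phi> ` UNIV" "\<lambda>y. card (\<phi> -` {y})", OF fibre] by simp
  also have "\<dots> \<le> (card ?K)\<^sup>2"
    using card_mono[OF _ im] by (simp add: power2_eq_square)
  finally have "(2 ^ m)\<^sup>2 \<le> (card ?K)\<^sup>2"
    by (simp add: card power_mult[symmetric] mult.commute)
  then have "2 ^ m \<le> card ?K"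
    using power2_le_imp_le by blast
  moreover have "card ?K \<le> 2 ^ m"
  proof -
    define p where "p = monom (1::'a) (2 ^ m) - monom 1 1"
    have gt: "(1::nat) < 2 ^ m"
      using False one_less_power[of "2::nat" m] by simp
    then have "coeff p (2 ^ m) = 1"
      by (simp add: p_def)
    then have "p \<noteq> 0"
      by auto
    moreover have "degree p \<le> 2 ^ m"
      unfolding p_def using gt
      by (intro degree_diff_le) (simp_all add: degree_monom_eq)
    moreover have "?K = {z. poly p z = 0}"
      by (simp add: p_def poly_monom)
    ultimately show ?thesis
      using card_poly_roots_bound[of p] by simp
  qed
  ultimately show ?thesis
    by simp
qed

theorem corollary3:
  fixes m n :: nat
    and F :: "'a::{field,finite} \<Rightarrow> 'a"
  assumes "m > 0"
    and "n \<in> {2 * m, 2 * m + 1}"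
    and "CARD('a) = 2 ^ n"
    and "F = (\<lambda>x. x ^ (2 ^ (m + 1) - 1))"
  shows "feistel_boomerang_extended_uniformity F = (if n = 2 * m then 2 ^ m else 2)"
proof -
  let ?N = "if n = 2 * m then 2 ^ m else 2 :: nat"
  have two: "(2::'a) = 0"
    using two_eq_0_if_CARD_power_2[OF assms(3)] .
  have iter: "(z ^ 2 ^ (m + 1)) ^ 2 ^ (m + 1) = (if n = 2 * m then z ^ 4 else z\<^sup>2)" for z :: 'a
  proof -
    have "(z ^ 2 ^ (m + 1)) ^ 2 ^ (m + 1) = z ^ 2 ^ (2 * m + 2)"
      by (simp add: power_mult[symmetric] power_add[symmetric] mult_2 del: power_Suc)
    \<comment> \<open>The exponent \<open>2 * m + 2\<close> exceeds \<open>n\<close> by 2 or 1,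
      which leaves a fourth power or a square.\<close>
    also have "\<dots> = (z ^ CARD('a)) ^ 2 ^ (2 * m + 2 - n)"
      using assms(2) unfolding assms(3) by (auto simp: power_mult[symmetric] power_add[symmetric])
    also have "\<dots> = z ^ 2 ^ (2 * m + 2 - n)"
      by (simp only: power_CARD_eq)
    finally show ?thesis
      using assms(2) by auto
  qed
  have one: "ddt F 1 1 = ?N"
  proof (cases "n = 2 * m")
    case True
    have "z ^ 2 ^ (m + 1) = z\<^sup>2 \<longleftrightarrow> z ^ 2 ^ m = z" for z :: 'a
    proof -
      have "z ^ 2 ^ (m + 1) + z\<^sup>2 = (z ^ 2 ^ m + z)\<^sup>2"
        using two by (simp add: power2_sum power_mult[symmetric] mult.commute)
      then show ?thesis
        by (metis char_2_add_eq_0_iff[OF two] zero_eq_power2)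
    qed
    then show ?thesis
      using ddt_1_1[OF two, of "m + 1"] card_fixed_points_half_frobenius[where 'a='a, of m] True assms(3)
      by (simp add: assms(4))
  next
    case False
    have "{z::'a. z ^ 2 ^ (m + 1) = z\<^sup>2} = {0, 1}"
    proof (intro equalityI subsetI)
      fix z :: 'a assume "z \<in> {z. z ^ 2 ^ (m + 1) = z\<^sup>2}"
      then have *: "z ^ 2 ^ (m + 1) = z\<^sup>2"
        by simp
      \<comment> \<open>Applying the power \<open>2 ^ (m + 1)\<close> to both sides of
        \<open>*\<close> gives \<open>z\<^sup>2 = z ^ 4\<close>.\<close>
      have "z\<^sup>2 = (z\<^sup>2) ^ 2 ^ (m + 1)"
        using iter[of z] False by (simp only: *) simp
      also have "\<dots> = (z ^ 2 ^ (m + 1))\<^sup>2"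
        by (simp only: power_mult[symmetric] mult.commute)
      also have "\<dots> = (z\<^sup>2)\<^sup>2"
        by (simp only: *)
      finally have "(z\<^sup>2)\<^sup>2 + z\<^sup>2 = 0"
        using char_2_add_eq_0_iff[OF two] by metis
      moreover have "(z * (z + 1))\<^sup>2 = (z\<^sup>2)\<^sup>2 + z\<^sup>2 + 2 * z ^ 3"
        by algebra
      ultimately have "(z * (z + 1))\<^sup>2 = 0"
        using two by simp
      then show "z \<in> {0, 1}"
        using char_2_add_eq_0_iff[OF two, of z 1] by simp
    qed auto
    then show ?thesis
      using ddt_1_1[OF two, of "m + 1"] False by (simp add: assms(4))
  qed
  have "ddt F 1 c \<le> ?N" for c
  proof (cases "c = 1")
    case False
    have "(z ^ 2 ^ (m + 1)) ^ 2 ^ (m + 1)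
        = of_bool (n \<noteq> 2 * m) * z\<^sup>2 + of_bool (n = 2 * m) * z ^ 4" for z :: 'a
      unfolding iter by simp
    then have "ddt F 1 c \<le> 2"
      unfolding assms(4)
      by (intro ddt_1_le_2[OF two _ False]) simp_all
    also have "2 \<le> ?N"
      using \<open>m > 0\<close> self_le_power[of "2::nat" m] by simp
    finally show ?thesis .
  qed (simp add: one)
  then have "ddt F a c \<le> ?N" if "a \<noteq> 0" for a c
    using ddt_power_eq[OF that] unfolding assms(4) by metis
  then show ?thesis
    using feistel_boomerang_extended_uniformity_eqI[OF two _ _ one] by simp
qed

end
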